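(* For any $\lambda,k\in\mathbb{N}$ such that $\lambda$ is odd and $k\ge4$, there exists a scroll $\mathcal{S}$ on $n=k\lambda$ vertices such that the period of its sum vector $\vec\Sigma(\mathcal{S})$ is $\lambda$.
   Context: Let $\mathcal{C}_n$ be the cycle graph on $\mathbb{Z}_n=\{1,\dots,n\}$ with edges $\{i,i+1\}$ (mod $n$). Independent sets are binary vectors $x\in\{0,1\}^n$ with no two cyclically adjacent $1$s. The toggle $\tau_k$ changes $x_k$ from $1$ to $0$, from $0$ to $1$ if the result is independent, and otherwise does nothing; $\tau=\tau_n\circ\cdots\circ\tau_1$, $x^{(i)}=\tau^i(x)$. A scroll on $n$ vertices is the array whose $i$-th row ($i\in\mathbb{Z}$) is $x^{(i)}$ for some independent set $x$ of $\mathcal{C}_n$; its period $T$ is the least $m>0$ with $x^{(m)}=x$. Its sum vector $\vec\Sigma(\mathcal{S})\in\mathbb{N}^n$ is the vector of column sums of the table with rows $x^{(0)},\dots,x^{(T-1)}$, and its period is its period as a cyclic word: the least $\lambda>0$ with $\Sigma_{j+\lambda}=\Sigma_j$ for all $j$ (indices mod $n$). *)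

theory Defs
  imports Main
begin

text \<open>
  The residue of \<open>j\<close> modulo \<open>n\<close>, taken in \<open>{1..n}\<close> (so multiples of \<open>n\<close> are
  represented by \<open>n\<close> rather than by \<open>0\<close>).
\<close>
definition cyc :: "nat \<Rightarrow> nat \<Rightarrow> nat" where
  "cyc n j = (if j mod n = 0 then n else j mod n)"

text \<open>For \<open>n \<ge> 3\<close> this is a simple graph; for \<open>n = 1\<close> it is a loop.\<close>
definition cycle_edges :: "nat \<Rightarrow> nat set set" where
  "cycle_edges n = {{i, cyc n (i + 1)} | i. i \<in> {1..n}}"

text \<open>
  Vectors indexed by \<open>{1..n}\<close> are functions on \<open>nat\<close>. Binary vectors are required
  to vanish outside \<open>{1..n}\<close>, so that equality of vectors is equality of functions.
\<close>
definition independent_sets :: "nat \<Rightarrow> (nat \<Rightarrow> nat) set" where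
  "independent_sets n =
     {x. (\<forall>i\<in>{1..n}. x i \<in> {0, 1}) \<and> (\<forall>i. i \<notin> {1..n} \<longrightarrow> x i = 0) \<and>
         (\<forall>i j. {i, j} \<in> cycle_edges n \<longrightarrow> \<not> (x i = 1 \<and> x j = 1))}"

definition toggle :: "nat \<Rightarrow> nat \<Rightarrow> (nat \<Rightarrow> nat) \<Rightarrow> (nat \<Rightarrow> nat)" where
  "toggle n k x =
     (if x k = 1 then x(k := 0)
      else if x(k := 1) \<in> independent_sets n then x(k := 1)
      else x)"

text \<open>\<open>fold\<close> applies the head of the list first, so \<open>toggle n 1\<close> acts first.\<close>
definition tau :: "nat \<Rightarrow> (nat \<Rightarrow> nat) \<Rightarrow> (nat \<Rightarrow> nat)" where
  "tau n = fold (toggle n) [1..<Suc n]"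

text \<open>
  Negative powers use the inverse of \<open>tau n\<close> as a permutation of the independent
  sets; see \<open>bij_betw_tau\<close> below.
\<close>
definition tau_power :: "nat \<Rightarrow> int \<Rightarrow> (nat \<Rightarrow> nat) \<Rightarrow> (nat \<Rightarrow> nat)" where
  "tau_power n i =
     (if 0 \<le> i then tau n ^^ nat i
      else inv_into (independent_sets n) (tau n) ^^ nat (- i))"

definition is_scroll :: "nat \<Rightarrow> (int \<Rightarrow> nat \<Rightarrow> nat) \<Rightarrow> bool" where
  "is_scroll n S \<longleftrightarrow> (\<exists>x\<in>independent_sets n. \<forall>i. S i = tau_power n i x)"

definition scroll_period :: "(int \<Rightarrow> nat \<Rightarrow> nat) \<Rightarrow> nat" where
  "scroll_period S = (LEAST m. 0 < m \<and> S (int m) = S 0)"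

definition sum_vector :: "(int \<Rightarrow> nat \<Rightarrow> nat) \<Rightarrow> nat \<Rightarrow> nat" where
  "sum_vector S j = (\<Sum>i<scroll_period S. S (int i) j)"

definition cyclic_word_period :: "nat \<Rightarrow> (nat \<Rightarrow> nat) \<Rightarrow> nat" where
  "cyclic_word_period n w = (LEAST l. 0 < l \<and> (\<forall>j\<in>{1..n}. w (cyc n (j + l)) = w j))"

lemma toggle_in: "x \<in> independent_sets n \<Longrightarrow> toggle n k x \<in> independent_sets n"
  by (fastforce simp: toggle_def independent_sets_def)

lemma toggle_toggle:
  assumes "x \<in> independent_sets n"
  shows "toggle n k (toggle n k x) = x"
proof -
  have "x k = 0 \<or> x k = 1"
    using assms by (cases "k \<in> {1..n}") (auto simp: independent_sets_def)
  then show ?thesis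
  proof
    assume "x k = 0"
    then have "x(k := 0) = x" by (simp add: fun_upd_idem)
    then show ?thesis using \<open>x k = 0\<close> by (simp add: toggle_def)
  next
    assume "x k = 1"
    then have "x(k := 1) = x" by (simp add: fun_upd_idem)
    then show ?thesis using \<open>x k = 1\<close> assms by (simp add: toggle_def)
  qed
qed

lemma bij_betw_toggle: "bij_betw (toggle n k) (independent_sets n) (independent_sets n)"
  by (rule bij_betw_byWitness[where f' = "toggle n k"]) (auto simp: toggle_in toggle_toggle)

lemma bij_betw_fold_toggle:
  "bij_betw (fold (toggle n) ks) (independent_sets n) (independent_sets n)"
proof (induction ks)
  case Nil
  show ?case by (simp add: bij_betw_def)
next
  case (Cons k ks)
  show ?case
    using bij_betw_trans[OF bij_betw_toggle Cons.IH] by (simp add: comp_def)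
qed

lemma bij_betw_tau: "bij_betw (tau n) (independent_sets n) (independent_sets n)"
  unfolding tau_def by (rule bij_betw_fold_toggle)

end

theory Submission
  imports Defs "HOL-Number_Theory.Cong"
begin

text \<open>
  Reading a scroll row by row gives a bi-infinite word \<open>y\<close> with
  \<open>y (t + n) = 1\<close> iff \<open>y t = y (t + 1) = y (t + n - 1) = 0\<close>. Consequently every \<open>1\<close> at \<open>t\<close> has
  exactly one \<open>1\<close> among \<open>t + 2\<close> and \<open>t + n + 1\<close>, and exactly one among
  \<open>t + 2 n - 1\<close> and \<open>t + 2 n - 2\<close>; the set of ones is a sumset \<open>W + V\<close> of the two walks
  arising in this way. Conversely, for suitable closed walks modulo \<open>P\<close> this sumset is a scroll: the
  number of ones in \<open>{s, s + 1, s + n - 1, s + n}\<close>, corrected for the one possible double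
  covering, does not depend on \<open>s\<close>, and so it is \<open>1\<close> if it is \<open>1\<close> on average.

  With \<open>lam = 2 c - 1\<close>, the walk \<open>V\<close> makes one step \<open>2 n - 1\<close> and \<open>c - 1\<close> steps \<open>2 n - 2\<close>, so
  \<open>P = (lam + 1) n - lam\<close> and \<open>gcd P n = lam\<close>: the column sums have period \<open>lam\<close>. The walk \<open>W\<close> makes
  \<open>r (lam + 1) - 1\<close> steps \<open>n + 1\<close>, where \<open>r\<close> is \<open>1\<close> or \<open>2\<close> and \<open>r \<equiv> n + 1\<close> modulo \<open>2\<close>, among
  \<open>(n + r - 1) / 2\<close> steps in total. Their order is chosen such that the starting points of the steps
  \<open>n + 1\<close> hit one residue class modulo \<open>lam\<close> more often than any other class, which excludes
  a smaller period.
\<close>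

section \<open>Toggling as a recurrence on the row-by-row word\<close>

lemma cyc_Suc:
  assumes "i \<in> {1..n}" "2 \<le> n"
  shows "cyc n (i + 1) = (if i = n then 1 else i + 1)"
  using assms by (auto simp: cyc_def mod_Suc)

lemma cyc_pred:
  assumes "i \<in> {1..n}"
  shows "cyc n (i + n - 1) = (if i = 1 then n else i - 1)"
proof (cases "i = 1")
  case False
  then have "i + n - 1 = (i - 1) + n" "i - 1 < n" "0 < i - 1" using assms by auto
  then show ?thesis using False unfolding cyc_def by (metis mod_add_self2 mod_less neq0_conv)
qed (simp add: cyc_def)

lemma insert_independent_iff:
  assumes x: "x \<in> independent_sets n" and n: "2 \<le> n" and k: "k \<in> {1..n}"
  shows "x(k := 1) \<in> independent_sets n \<longleftrightarrow>
         x (cyc n (k + 1)) = 0 \<and> x (cyc n (k + n - 1)) = 0"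
proof -
  note succ = cyc_Suc[OF _ n] and pred = cyc_pred[OF k]
  have edge: "{i, j} \<in> cycle_edges n \<longleftrightarrow>
      i \<in> {1..n} \<and> j = (if i = n then 1 else i + 1) \<or>
      j \<in> {1..n} \<and> i = (if j = n then 1 else j + 1)" for i j
  proof -
    have "{i, j} \<in> cycle_edges n \<longleftrightarrow>
        (\<exists>a\<in>{1..n}. {i, j} = {a, if a = n then 1 else a + 1})"
      unfolding cycle_edges_def using succ by fastforce
    then show ?thesis unfolding doubleton_eq_iff by blast
  qed
  have x01: "x i \<in> {0, 1}" for i
    using x by (cases "i \<in> {1..n}") (auto simp: independent_sets_def)
  have xe: "\<not> (x i = 1 \<and> x j = 1)" if "{i, j} \<in> cycle_edges n" for i j
    using x that by (auto simp: independent_sets_def)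
  show ?thesis
  proof
    assume A: "x(k := 1) \<in> independent_sets n"
    have *: "x j = 0" if "{k, j} \<in> cycle_edges n" "j \<noteq> k" for j
    proof -
      have "\<not> ((x(k := 1)) k = 1 \<and> (x(k := 1)) j = 1)"
        using A that(1) unfolding independent_sets_def by blast
      then show ?thesis using x01[of j] that(2) by auto
    qed
    show "x (cyc n (k + 1)) = 0 \<and> x (cyc n (k + n - 1)) = 0"
      unfolding pred succ[OF k] using k n
      by (intro conjI *) (auto simp: edge)
  next
    assume A: "x (cyc n (k + 1)) = 0 \<and> x (cyc n (k + n - 1)) = 0"
    have nb: "x j = 0 \<and> j \<noteq> k" if "{k, j} \<in> cycle_edges n" for j
      using A that k n unfolding pred succ[OF k] edge by (auto split: if_splits)
    have "\<not> ((x(k := 1)) i = 1 \<and> (x(k := 1)) j = 1)" if e: "{i, j} \<in> cycle_edges n" for i j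
      using xe[OF e] nb[of i] nb[of j] e by (auto simp: insert_commute)
    moreover have "\<forall>i\<in>{1..n}. (x(k := 1)) i \<in> {0, 1}" using x01 by auto
    moreover have "\<forall>i. i \<notin> {1..n} \<longrightarrow> (x(k := 1)) i = 0"
      using x k by (auto simp: independent_sets_def)
    ultimately show "x(k := 1) \<in> independent_sets n"
      unfolding independent_sets_def by blast
  qed
qed

definition window :: "nat \<Rightarrow> (nat \<Rightarrow> nat) \<Rightarrow> nat \<Rightarrow> nat \<Rightarrow> nat" where
  "window n y t j = (if j \<in> {1..n} then y (t + j) else 0)"

lemma tau_window:
  assumes n: "2 \<le> n"
    and rec: "\<And>t. y (t + n) = of_bool (y t = 0 \<and> y (t + 1) = 0 \<and> y (t + n - 1) = 0)"
    and ind: "window n y t \<in> independent_sets n"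
  shows "tau n (window n y t) = window n y (t + n)"
proof -
  \<comment> \<open>\<open>z k\<close> is the row in mid-sweep: its first \<open>k\<close> entries
    already belong to the next row. The neighbours of the next vertex then sit at offsets
    \<open>1\<close> and \<open>n - 1\<close> in the word, also across the wrap-around: vertex
    \<open>1\<close> sees the old entry \<open>n\<close>, vertex \<open>n\<close> the new entry
    \<open>1\<close>.\<close>
  define z where "z k j = (if j \<in> {1..n} then y (t + (if j \<le> k then n + j else j)) else 0)" for k j
  have "fold (toggle n) [1..<Suc k] (window n y t) = z k \<and> z k \<in> independent_sets n"
    if "k \<le> n" for k
    using that
  proof (induction k)
    case 0
    have "z 0 = window n y t" by (auto simp: z_def window_def)
    then show ?case using ind by simp
  next
    case (Suc k)
    have IH: "fold (toggle n) [1..<Suc k] (window n y t) = z k" "z k \<in> independent_sets n"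
      using Suc by auto
    let ?k = "Suc k"
    have km: "?k \<in> {1..n}" using Suc.prems by auto
    have zk: "z k ?k = y (t + ?k)" using km by (simp add: z_def)
    have zs: "z k (cyc n (?k + 1)) = y (t + ?k + 1)"
      unfolding cyc_Suc[OF km n] using km n by (auto simp: z_def add_ac)
    have zp: "z k (cyc n (?k + n - 1)) = y (t + ?k + n - 1)"
      unfolding cyc_pred[OF km] using km n by (auto simp: z_def add_ac)
    have y01: "z k ?k = 0 \<or> z k ?k = 1"
      using IH(2) km unfolding independent_sets_def by blast
    have zSuc: "z ?k = (z k)(?k := y (t + ?k + n))"
      using km by (auto simp: z_def fun_eq_iff add_ac le_Suc_eq)
    have "toggle n ?k (z k) = z ?k"
    proof (cases "z k ?k = 1")
      case True
      then have "y (t + ?k + n) = 0" using rec[of "t + ?k"] zk by simp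
      then show ?thesis using True zSuc by (simp add: toggle_def)
    next
      case False
      then have z0: "z k ?k = 0" using y01 by simp
      have "y (t + ?k + n) = of_bool ((z k)(?k := 1) \<in> independent_sets n)"
        using rec[of "t + ?k"] zk zs zp z0 insert_independent_iff[OF IH(2) n km] by simp
      moreover have "(z k)(?k := 0) = z k" using z0 by (simp add: fun_upd_idem)
      ultimately show ?thesis using z0 zSuc by (auto simp: toggle_def)
    qed
    moreover have "fold (toggle n) [1..<Suc ?k] (window n y t) = toggle n ?k (z k)"
      using IH(1) by simp
    ultimately show ?case using toggle_in[OF IH(2)] by metis
  qed
  from this[of n] have "tau n (window n y t) = z n" by (simp add: tau_def)
  also have "z n = window n y (t + n)" by (auto simp: z_def window_def add_ac)
  finally show ?thesis .
qed

lemma tau_funpow_window: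
  assumes n: "2 \<le> n"
    and rec: "\<And>t. y (t + n) = of_bool (y t = 0 \<and> y (t + 1) = 0 \<and> y (t + n - 1) = 0)"
    and ind: "window n y 0 \<in> independent_sets n"
  shows "(tau n ^^ i) (window n y 0) = window n y (n * i)"
proof -
  have "(tau n ^^ i) (window n y 0) = window n y (n * i) \<and> window n y (n * i) \<in> independent_sets n"
  proof (induction i)
    case (Suc i)
    have "tau n (window n y (n * i)) = window n y (n * i + n)"
      using Suc by (intro tau_window[OF n rec]) auto
    moreover have "tau n (window n y (n * i)) \<in> independent_sets n"
      using Suc bij_betw_tau by (auto simp: bij_betw_def)
    ultimately show ?case using Suc by (simp add: add.commute)
  qed (use ind in simp)
  then show ?thesis by simp
qed

section \<open>Column sums and counting of residues\<close>

text \<open>Any return time can replace the least period: it is a multiple of it, so column sums are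
  only scaled.\<close>

lemma scroll_sum_multiple:
  assumes rows: "\<And>i. S (int i) = (f ^^ i) (S 0)" and T: "0 < T" "S (int T) = S 0"
  obtains r where "0 < r" "\<And>j. (\<Sum>i<T. S (int i) j) = r * sum_vector S j"
proof -
  let ?p = "scroll_period S"
  have p: "0 < ?p" "S (int ?p) = S 0"
    using LeastI[of "\<lambda>m. 0 < m \<and> S (int m) = S 0" T] T by (auto simp: scroll_period_def)
  have shift: "S (int (i + ?p)) = S (int i)" for i
    using p(2) by (simp only: rows funpow_add o_apply)
  have shift': "S (int (i + r * ?p)) = S (int i)" for i r
  proof (induction r)
    case (Suc r)
    then show ?case using shift[of "i + r * ?p"] by (simp add: algebra_simps)
  qed simp
  have "T mod ?p = 0"
  proof (rule ccontr)
    assume "T mod ?p \<noteq> 0"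
    moreover have "S (int (T mod ?p)) = S 0"
      using shift'[of "T mod ?p" "T div ?p"] T(2) by (simp add: mult.commute del: of_nat_add of_nat_mult)
    ultimately have "?p \<le> T mod ?p"
      unfolding scroll_period_def by (intro Least_le) auto
    then show False using p(1) mod_less_divisor[of ?p T] by linarith
  qed
  then obtain r where r: "T = r * ?p" by (metis dvd_div_mult_self mod_0_imp_dvd)
  show ?thesis
  proof
    show "0 < r" using r T by (cases r) auto
    fix j
    have "(\<Sum>i<T. S (int i) j) = (\<Sum>d<r. \<Sum>i = d * ?p..<d * ?p + ?p. S (int i) j)"
      unfolding r by (rule sum.nat_group[symmetric])
    also have "\<dots> = (\<Sum>d<r. sum_vector S j)"
    proof (rule sum.cong[OF refl])
      fix d
      have "(\<Sum>i = d * ?p..<d * ?p + ?p. S (int i) j) = (\<Sum>i<?p. S (int (i + d * ?p)) j)"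
        using sum.shift_bounds_nat_ivl[of "\<lambda>i. S (int i) j" 0 "d * ?p" ?p]
        by (simp add: lessThan_atLeast0 add.commute)
      then show "(\<Sum>i = d * ?p..<d * ?p + ?p. S (int i) j) = sum_vector S j"
        by (simp only: shift' sum_vector_def)
    qed
    finally show "(\<Sum>i<T. S (int i) j) = r * sum_vector S j" by simp
  qed
qed

text \<open>\<open>k\<close> is invertible modulo \<open>T\<close>, so \<open>k * l * i\<close> for
  \<open>i < T\<close> meets each multiple of \<open>l\<close> modulo \<open>l * T\<close>
  once.\<close>

lemma sum_of_bool_dvd:
  fixes k l u :: int
  assumes "0 < T" "coprime k (int T)" "l \<noteq> 0"
  shows "(\<Sum>i<T. of_bool (l * int T dvd u - k * l * int i)) = (of_bool (l dvd u) :: int)"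
proof (cases "l dvd u")
  case False
  have "\<not> l * int T dvd u - k * l * int i" for i
  proof
    assume "l * int T dvd u - k * l * int i"
    then have "l dvd u - k * l * int i" by (rule dvd_mult_left)
    then show False using False by (simp add: dvd_diff_left_iff)
  qed
  then show ?thesis using False by simp
next
  case True
  then obtain v where v: "u = l * v" ..
  have eq: "l * int T dvd u - k * l * int i \<longleftrightarrow> int T dvd v - k * int i" for i
  proof -
    have "u - k * l * int i = l * (v - k * int i)" by (simp add: v algebra_simps)
    then show ?thesis using assms(3) by simp
  qed
  obtain w where w: "[k * w = v] (mod int T)"
    using cong_solve_coprime_int[OF assms(2)] by (metis cong_scalar_right mult.assoc mult.commute mult_1)
  define i0 where "i0 = nat (w mod int T)"
  have i0: "int i0 = w mod int T" "i0 < T"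
    using assms(1) by (auto simp: i0_def nat_less_iff)
  have "int T dvd v - k * int i \<longleftrightarrow> i = i0" if "i < T" for i
  proof -
    have "int T dvd v - k * int i \<longleftrightarrow> [k * int i = v] (mod int T)"
      by (metis cong_iff_dvd_diff cong_sym_eq)
    also have "\<dots> \<longleftrightarrow> [k * int i = k * w] (mod int T)"
      using w by (meson cong_sym cong_trans)
    also have "\<dots> \<longleftrightarrow> [int i = w] (mod int T)"
      using assms(2) by (rule cong_mult_lcancel)
    also have "\<dots> \<longleftrightarrow> i = i0"
      using that i0 by (auto simp: cong_def)
    finally show ?thesis .
  qed
  then have "(\<Sum>i<T. of_bool (l * int T dvd u - k * l * int i)) = (\<Sum>i<T. if i = i0 then 1 else (0::int))"
    by (intro sum.cong) (auto simp: eq)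
  then show ?thesis using True i0 by simp
qed


section \<open>Counting representations in the sumset of two walks\<close>

text \<open>
  \<open>W\<close> is the walk whose \<open>a\<close>-th step is \<open>n + 1\<close> for \<open>a \<in> I\<close> and \<open>2\<close> otherwise. Modulo a divisor of
  \<open>c * e + 1\<close>, which is the length of the walk \<open>V\<close>, the \<open>c\<close> points of \<open>V\<close> are the
  \<open>- b * e\<close> with \<open>b < c\<close>, so that \<open>hits\<close> counts the representations of \<open>t\<close> in \<open>W + V\<close>.
\<close>
locale snake_word =
  fixes n c m :: nat and I :: "nat set"
  assumes n: "2 \<le> n" and c: "0 < c" and I: "I \<subseteq> {..<m}"
begin

definition W :: "nat \<Rightarrow> int" where
  "W a = (\<Sum>j<a. if j \<in> I then int n + 1 else 2)"

definition cnt :: "int \<Rightarrow> nat set \<Rightarrow> int \<Rightarrow> int" where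
  "cnt d J t = (\<Sum>a\<in>J. of_bool (d dvd W a - t))"

definition e :: int where "e = 2 * int n - 2"

definition hits :: "int \<Rightarrow> nat set \<Rightarrow> int \<Rightarrow> int" where
  "hits d J t = (\<Sum>b<c. cnt d J (t + int b * e))"

abbreviation "U \<equiv> {..<m}"

lemma cnt_nonneg: "0 \<le> cnt d J t"
  by (simp add: cnt_def sum_nonneg)

lemma hits_nonneg: "0 \<le> hits d J t"
  by (simp add: hits_def sum_nonneg cnt_nonneg)

lemma cnt_cong:
  assumes "d dvd s - t"
  shows "cnt d J s = cnt d J t"
proof -
  have "d dvd W a - s \<longleftrightarrow> d dvd W a - t" for a
    using dvd_add_left_iff[OF assms, of "W a - s"] by simp
  then show ?thesis by (simp add: cnt_def)
qed

lemma hits_cong: "d dvd s - t \<Longrightarrow> hits d J s = hits d J t"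
  unfolding hits_def by (intro sum.cong refl cnt_cong) simp

lemma cnt_split: "cnt d U t = cnt d (U - I) t + cnt d I t"
  unfolding cnt_def by (rule sum.subset_diff[OF I]) simp

text \<open>\<open>W\<close> closes up modulo \<open>d\<close>, so its points are also the ends of
  its steps.\<close>

lemma cnt_step:
  assumes "d dvd W m"
  shows "cnt d U t = cnt d (U - I) (t - 2) + cnt d I (t - int n - 1)"
proof -
  define f where "f a = (of_bool (d dvd W a - t) :: int)" for a
  have "f m = f 0"
  proof -
    have "d dvd W m - t \<longleftrightarrow> d dvd W 0 - t"
      using dvd_add_right_iff[OF assms, of "- t"] by (simp add: W_def)
    then show ?thesis by (simp add: f_def)
  qed
  then have "(\<Sum>a<m. f a) = (\<Sum>a<m. f (Suc a))"
    using sum.lessThan_Suc_shift[of f m] by simp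
  also have "\<dots> = (\<Sum>a\<in>U - I. f (Suc a)) + (\<Sum>a\<in>I. f (Suc a))"
    using sum.subset_diff[OF I] by simp
  also have "(\<Sum>a\<in>U - I. f (Suc a)) = cnt d (U - I) (t - 2)"
    unfolding cnt_def by (intro sum.cong refl) (simp add: f_def W_def algebra_simps)
  also have "(\<Sum>a\<in>I. f (Suc a)) = cnt d I (t - int n - 1)"
    unfolding cnt_def by (intro sum.cong refl) (simp add: f_def W_def algebra_simps)
  finally show ?thesis by (simp add: cnt_def f_def)
qed

lemma hits_split: "hits d U t = hits d (U - I) t + hits d I t"
  by (simp add: hits_def sum.distrib cnt_split)

lemma hits_step:
  assumes "d dvd W m"
  shows "hits d U t = hits d (U - I) (t - 2) + hits d I (t - int n - 1)"
proof -
  have "hits d U t = (\<Sum>b<c. cnt d (U - I) (t + int b * e - 2) + cnt d I (t + int b * e - int n - 1))"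
    unfolding hits_def by (intro sum.cong refl cnt_step assms)
  then show ?thesis by (simp add: hits_def sum.distrib algebra_simps)
qed

text \<open>The sum over \<open>b\<close> telescopes to its two ends, and \<open>c * e\<close> is
  \<open>-1\<close> modulo \<open>d\<close>.\<close>

lemma hits_shift:
  assumes "d dvd int c * e + 1"
  shows "hits d J (t + e) - hits d J t = cnt d J (t - 1) - cnt d J t"
proof -
  have "hits d J (t + e) = (\<Sum>b<c. cnt d J (t + int (Suc b) * e))"
    unfolding hits_def by (intro sum.cong refl) (simp add: algebra_simps)
  moreover have "(\<Sum>b<c. cnt d J (t + int (Suc b) * e)) + cnt d J t =
      hits d J t + cnt d J (t + int c * e)"
    using sum.lessThan_Suc_shift[of "\<lambda>b. cnt d J (t + int b * e)" c]
    by (simp add: hits_def)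
  moreover have "cnt d J (t + int c * e) = cnt d J (t - 1)"
    using assms by (intro cnt_cong) (simp add: algebra_simps)
  ultimately show ?thesis by simp
qed

text \<open>
  The subtracted term counts the \<open>t\<close> in \<open>W + V\<close> at which \<open>W\<close> continues with \<open>n + 1\<close> and \<open>V\<close> with
  \<open>2 n - 1\<close>: then \<open>t + n + 1\<close> and \<open>t + 2 n - 1\<close> are ones which both cover \<open>s = t + n\<close>.
\<close>
definition cover :: "int \<Rightarrow> int \<Rightarrow> int" where
  "cover d s = hits d U s + hits d U (s + 1) + hits d U (s + int n - 1) + hits d U (s + int n)
     - cnt d I (s - int n)"

lemma cover_const:
  assumes d: "d dvd int c * e + 1" "d dvd W m"
  shows "cover d s = cover d 0"
proof -
  have "cover d (s + 1) = cover d s" for s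
  proof -
    \<comment> \<open>Passing to \<open>s + 1\<close> replaces \<open>s\<close> and
      \<open>s + n - 1\<close> by \<open>s + 2\<close> and \<open>s + n + 1\<close>. By
      \<open>hits_step\<close> the short steps cancel; the long ones leave a difference over the
      distance \<open>e\<close>, which is the change of the correction term.\<close>
    have "hits d U (s + 2) = hits d (U - I) s + hits d I (s - int n + 1)"
      using hits_step[OF d(2), of "s + 2"] by (simp add: algebra_simps)
    moreover have "hits d U (s + int n + 1) = hits d (U - I) (s + int n - 1) + hits d I s"
      using hits_step[OF d(2), of "s + int n + 1"] by (simp add: algebra_simps)
    moreover have "hits d I (s + int n - 1) - hits d I (s - int n + 1) =
        cnt d I (s - int n) - cnt d I (s + 1 - int n)"
      using hits_shift[OF d(1), of I "s - int n + 1"] by (simp add: e_def algebra_simps)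
    ultimately show ?thesis
      using hits_split[of d s] hits_split[of d "s + int n - 1"]
      by (simp add: cover_def algebra_simps)
  qed
  note step = this
  show ?thesis
  proof (induction s rule: int_induct[where k = 0])
    case (step2 i)
    then show ?case using step[of "i - 1"] by simp
  qed (simp_all add: step)
qed

lemma sum_cnt:
  assumes "0 < P" "finite J"
  shows "(\<Sum>i<P. cnt (int P) J (s + int i)) = int (card J)"
proof -
  have "(\<Sum>i<P. cnt (int P) J (s + int i)) =
      (\<Sum>a\<in>J. \<Sum>i<P. of_bool (int P dvd W a - (s + int i)))"
    unfolding cnt_def by (rule sum.swap)
  also have "\<dots> = (\<Sum>a\<in>J. 1)"
  proof (rule sum.cong[OF refl])
    fix a
    show "(\<Sum>i<P. of_bool (int P dvd W a - (s + int i))) = (1::int)"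
      using sum_of_bool_dvd[OF assms(1), of 1 1 "W a - s"]
      by (simp add: diff_diff_eq del: sum_of_bool_eq)
  qed
  finally show ?thesis by simp
qed

lemma sum_hits:
  assumes "0 < P" "finite J"
  shows "(\<Sum>i<P. hits (int P) J (s + int i)) = int c * int (card J)"
proof -
  have "(\<Sum>i<P. hits (int P) J (s + int i)) =
      (\<Sum>b<c. \<Sum>i<P. cnt (int P) J (s + int b * e + int i))"
    unfolding hits_def by (subst sum.swap) (simp add: algebra_simps)
  then show ?thesis using assms by (simp add: sum_cnt)
qed

lemma W_card: "W a = 2 * int a + (int n - 1) * int (card (I \<inter> {..<a}))"
proof (induction a)
  case (Suc a)
  have "I \<inter> {..<Suc a} = (if a \<in> I then insert a (I \<inter> {..<a}) else I \<inter> {..<a})"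
    by (auto simp: less_Suc_eq)
  then show ?case using Suc by (simp add: W_def algebra_simps)
qed (simp add: W_def)

text \<open>Entries of a column are \<open>n\<close> apart, and \<open>T\<close> of them meet every
  lift modulo \<open>l * T\<close> of a residue modulo \<open>l\<close> once; summing thus lowers
  the modulus to \<open>l\<close>.\<close>

lemma sum_hits_columns:
  assumes "0 < T" "0 < l" "n = k * l" "coprime k T"
  shows "(\<Sum>i<T. hits (int (l * T)) J (t + int (n * i))) = hits (int l) J t"
proof -
  have "(\<Sum>i<T. cnt (int (l * T)) J (s + int (n * i))) = cnt (int l) J s" for s
  proof -
    have "(\<Sum>i<T. of_bool (int (l * T) dvd W a - (s + int (n * i)))) = (of_bool (int l dvd W a - s) :: int)" for a
      using sum_of_bool_dvd[OF assms(1), of "int k" "int l" "W a - s"] assms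
      by (simp add: diff_diff_eq mult.assoc del: sum_of_bool_eq)
    then show ?thesis unfolding cnt_def by (subst sum.swap) (simp del: sum_of_bool_eq)
  qed
  from this[of "t + int b * e" for b] show ?thesis
    unfolding hits_def by (subst sum.swap) (simp add: algebra_simps)
qed

text \<open>
  The differences of \<open>hits\<close> determine those of \<open>cnt l I\<close>, so \<open>cnt l I\<close> is \<open>p\<close>-periodic up to an
  additive constant, which vanishes because \<open>l\<close> shifts by \<open>p\<close> change nothing.
\<close>
lemma cnt_periodic_if_hits_periodic:
  assumes l: "l dvd int c * e + 1" "l dvd W m" "l dvd int n" "0 < l"
    and per: "\<And>t. hits l U (t + p) = hits l U t"
  shows "cnt l I (t + p) = cnt l I t"
proof -
  define D where "D t = cnt l U (t - 1) - cnt l U t" for t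
  have D: "D t = hits l U (t + e) - hits l U t" for t
    using hits_shift[OF l(1), of U t] by (simp add: D_def)
  have D_per: "D (t + p) = D t" for t
    using per[of t] per[of "t + e"] by (simp add: D algebra_simps)
  have I_diff: "cnt l I (t - 1) - cnt l I t = D t + D (t + 1)" for t
  proof -
    \<comment> \<open>Modulo \<open>l\<close> a step \<open>n + 1\<close> is a step
      \<open>1\<close>, so differences of \<open>cnt l U\<close> at distance two isolate
      \<open>I\<close>.\<close>
    have "cnt l I (t - int n) = cnt l I t" using l(3) by (intro cnt_cong) simp
    then have "cnt l U (t + 1) = cnt l (U - I) (t - 1) + cnt l I t"
      using cnt_step[OF l(2), of "t + 1"] by (simp add: algebra_simps)
    then show ?thesis using cnt_split[of l "t - 1"] by (simp add: D_def)
  qed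
  define \<delta> where "\<delta> t = cnt l I (t + p) - cnt l I t" for t
  have step: "\<delta> (t - 1) = \<delta> t" for t
    using I_diff[of t] I_diff[of "t + p"] D_per[of t] D_per[of "t + 1"]
    by (simp add: \<delta>_def algebra_simps)
  have const: "\<delta> t = \<delta> 0" for t
  proof (induction t rule: int_induct[where k = 0])
    case (step1 i)
    then show ?case using step[of "i + 1"] by simp
  qed (simp_all add: step)
  have "cnt l I (t + int r * p) = cnt l I t + int r * \<delta> 0" for r
  proof (induction r)
    case (Suc r)
    then show ?case using const[of "t + int r * p"] by (simp add: \<delta>_def algebra_simps)
  qed simp
  from this[of "nat l"] have "cnt l I (t + l * p) = cnt l I t + l * \<delta> 0" using l(4) by simp
  moreover have "cnt l I (t + l * p) = cnt l I t" by (intro cnt_cong) simp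
  ultimately have "\<delta> 0 = 0" using l(4) by simp
  then show ?thesis using const[of t] by (simp add: \<delta>_def)
qed

end

section \<open>Closed walks whose sumset is a scroll\<close>

locale closed_snake_word = snake_word +
  fixes P :: nat
  assumes P: "int P = int c * e + 1"
    and closed: "int P dvd W m"
    and area: "4 * c * m = P + card I"
begin

abbreviation "x \<equiv> hits (int P) U"

text \<open>\<open>area\<close> says that the constant \<open>cover\<close> has average 1: over
  \<open>P\<close> positions each of its four terms sums to \<open>c * m\<close> and the correction
  to \<open>card I\<close>.\<close>

lemma cover_eq_1: "cover (int P) s = 1"
proof -
  have pos: "0 < P"
  proof -
    have "0 \<le> int c * e" using n by (simp add: e_def)
    then show ?thesis using P by linarith
  qed
  have fin: "finite I" using I finite_subset by blast
  have shift: "(\<Sum>i<P. x (int i + r)) = int c * int m" for r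
    using sum_hits[OF pos, of U r] by (simp add: add.commute)
  have "(\<Sum>i<P. cover (int P) (int i)) = 4 * int c * int m - int (card I)"
    unfolding cover_def
    using shift[of 0] shift[of 1] shift[of "int n - 1"] shift[of "int n"]
      sum_cnt[OF pos fin, of "- int n"]
    by (simp add: sum.distrib sum_subtractf algebra_simps)
  also have "\<dots> = int P"
    using area by (metis add_diff_cancel_right' of_nat_add of_nat_mult of_nat_numeral)
  also have "(\<Sum>i<P. cover (int P) (int i)) = (\<Sum>i<P. cover (int P) s)"
    by (intro sum.cong refl) (metis P closed cover_const dvd_refl)
  finally show ?thesis using pos by simp
qed

text \<open>A long step from \<open>s - n\<close> ends at \<open>s + 1\<close>, counted with
  \<open>b = 0\<close>; and \<open>s - n\<close> is \<open>s + n - 1 + (c - 1) * e\<close> modulo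
  \<open>P\<close>, counted with \<open>b = c - 1\<close>.\<close>

lemma overlap_le: "cnt (int P) I (s - int n) \<le> x (s + 1)" "cnt (int P) I (s - int n) \<le> x (s + int n - 1)"
proof -
  have "cnt (int P) I (s - int n) \<le> cnt (int P) U (s + 1)"
    using cnt_step[OF closed, of "s + 1"] cnt_nonneg[of "int P" "U - I" "s - 1"]
    by (simp add: algebra_simps)
  also have "\<dots> \<le> x (s + 1)"
    using member_le_sum[of 0 "{..<c}" "\<lambda>b. cnt (int P) U (s + 1 + int b * e)"] c
    by (simp add: hits_def cnt_nonneg)
  finally show "cnt (int P) I (s - int n) \<le> x (s + 1)" .
  have "cnt (int P) I (s - int n) \<le> cnt (int P) U (s - int n)"
    using cnt_split[of "int P" "s - int n"] cnt_nonneg[of "int P" "U - I" "s - int n"] by simp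
  also have "\<dots> = cnt (int P) U (s + int n - 1 + int (c - 1) * e)"
  proof (rule cnt_cong)
    have "s - int n - (s + int n - 1 + int (c - 1) * e) = - int P"
      using c by (simp add: P e_def of_nat_diff algebra_simps)
    then show "int P dvd s - int n - (s + int n - 1 + int (c - 1) * e)" by simp
  qed
  also have "\<dots> \<le> x (s + int n - 1)"
    unfolding hits_def
    using member_le_sum[of "c - 1" "{..<c}" "\<lambda>b. cnt (int P) U (s + int n - 1 + int b * e)"] c
    by (simp add: cnt_nonneg)
  finally show "cnt (int P) I (s - int n) \<le> x (s + int n - 1)" .
qed

lemma x_rec: "x (s + int n) = of_bool (x s = 0 \<and> x (s + 1) = 0 \<and> x (s + int n - 1) = 0)"
  \<comment> \<open>Four nonnegative terms minus the overlap give 1, and the overlap is at most the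
    second and at most the third. So the last term is 1 if the first three vanish and 0
    otherwise.\<close>
  using cover_eq_1[of s] overlap_le[of s] hits_nonneg[of "int P" U] cnt_nonneg[of "int P" I "s - int n"]
  unfolding cover_def
  by (smt (verit) of_bool_eq)

lemma x_le_1: "x s \<le> 1"
  using x_rec[of "s - int n"] by simp

lemma x_adjacent: "x s = 0 \<or> x (s + 1) = 0"
  using x_rec[of "s - int n + 1"] by (auto simp: algebra_simps)

definition y :: "nat \<Rightarrow> nat" where
  "y t = nat (x (int t))"

lemma y_eq_0_iff: "y t = 0 \<longleftrightarrow> x (int t) = 0"
  using hits_nonneg[of "int P" U "int t"] by (auto simp: y_def)

lemma y_rec: "y (t + n) = of_bool (y t = 0 \<and> y (t + 1) = 0 \<and> y (t + n - 1) = 0)"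
proof -
  have "int (t + n - 1) = int t + int n - 1" using n by simp
  then show ?thesis
    unfolding y_eq_0_iff using x_rec[of "int t"] by (simp add: y_def algebra_simps)
qed

lemma window_independent: "window n y 0 \<in> independent_sets n"
proof -
  have adj: "\<not> (window n y 0 a = 1 \<and> window n y 0 (cyc n (a + 1)) = 1)" if a: "a \<in> {1..n}" for a
  proof (cases "a = n")
    case True
    have "y n = 0 \<or> y 1 = 0" using y_rec[of 0] by auto
    then show ?thesis unfolding cyc_Suc[OF a n] using True by (auto simp: window_def)
  next
    case False
    have "y a = 0 \<or> y (a + 1) = 0"
      using x_adjacent[of "int a"] by (auto simp: y_eq_0_iff algebra_simps)
    then show ?thesis unfolding cyc_Suc[OF a n] using False by (auto simp: window_def)
  qed
  have "\<not> (window n y 0 i = 1 \<and> window n y 0 j = 1)" if edge: "{i, j} \<in> cycle_edges n" for i j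
  proof -
    obtain a where "a \<in> {1..n}" "{i, j} = {a, cyc n (a + 1)}"
      using edge unfolding cycle_edges_def by blast
    then show ?thesis using adj[of a] by (auto simp: doubleton_eq_iff)
  qed
  moreover have "y t \<in> {0, 1}" for t
    using x_le_1[of "int t"] by (auto simp: y_def)
  ultimately show ?thesis
    by (auto simp: independent_sets_def window_def)
qed

text \<open>Up to a positive factor the column sums are \<open>hits\<close> modulo \<open>l\<close>.
  A period of them passes to \<open>cnt (int l) I\<close>, where \<open>period_I\<close> makes it a
  multiple of \<open>l\<close>.\<close>

lemma scroll_exists:
  assumes T: "0 < T" "P = l * T" and l: "0 < l" "n = k * l" and cop: "coprime k T"
    and period_I: "\<And>p. (\<And>t. cnt (int l) I (t + p) = cnt (int l) I t) \<Longrightarrow> int l dvd p"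
  shows "\<exists>S. is_scroll n S \<and> cyclic_word_period n (sum_vector S) = l"
proof -
  define S where "S i = tau_power n i (window n y 0)" for i
  have rows: "S (int i) = window n y (n * i)" for i
    using tau_funpow_window[OF n y_rec window_independent, of i]
    by (simp add: S_def tau_power_def)
  have n0: "0 < n" using n by simp
  \<comment> \<open>\<open>n * T\<close> equals \<open>k * P\<close>.\<close>
  have "y (n * T + j) = y j" for j
  proof -
    have "x (int (n * T + j)) = x (int j)"
      by (intro hits_cong) (simp add: T l)
    then show ?thesis by (simp add: y_def)
  qed
  then have ST: "S (int T) = S 0"
    using rows[of T] rows[of 0] by (auto simp: window_def fun_eq_iff)
  have rows': "S (int i) = (tau n ^^ i) (S 0)" for i
    by (simp add: S_def tau_power_def)
  obtain r where r: "0 < r" "\<And>j. (\<Sum>i<T. S (int i) j) = r * sum_vector S j"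
    using scroll_sum_multiple[OF rows' T(1) ST] by metis
  let ?H = "hits (int l) U"
  have col: "int (r * sum_vector S j) = ?H (int j)" if "j \<in> {1..n}" for j
  proof -
    have "int (r * sum_vector S j) = (\<Sum>i<T. int (S (int i) j))"
      unfolding r(2)[symmetric] by simp
    also have "\<dots> = (\<Sum>i<T. x (int j + int (n * i)))"
      using that by (intro sum.cong refl) (simp add: rows window_def y_def hits_nonneg add.commute)
    also have "\<dots> = ?H (int j)"
      using sum_hits_columns[OF T(1) l cop] by (simp add: T(2))
    finally show ?thesis .
  qed
  have H_cong: "?H s = ?H t" if "int n dvd s - t" for s t
    using that l(2) by (intro hits_cong) (auto intro: dvd_trans)
  have cyc_in: "cyc n j \<in> {1..n}" and cyc_dvd: "int n dvd int (cyc n j) - int j" for j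
  proof -
    show "cyc n j \<in> {1..n}"
      using n0 mod_less_divisor[OF n0, of j] by (auto simp: cyc_def simp del: mod_less_divisor)
    have "[cyc n j = j] (mod n)" by (simp add: cyc_def cong_def)
    then show "int n dvd int (cyc n j) - int j"
      by (metis cong_iff_dvd_diff cong_int_iff)
  qed
  have per_iff: "sum_vector S (cyc n (j + p)) = sum_vector S j \<longleftrightarrow> ?H (int j + int p) = ?H (int j)"
    if "j \<in> {1..n}" for j p
  proof -
    have "sum_vector S (cyc n (j + p)) = sum_vector S j \<longleftrightarrow>
        int (r * sum_vector S (cyc n (j + p))) = int (r * sum_vector S j)"
      using r(1) by simp
    also have "\<dots> \<longleftrightarrow> ?H (int (cyc n (j + p))) = ?H (int j)"
      by (simp only: col[OF that] col[OF cyc_in])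
    also have "?H (int (cyc n (j + p))) = ?H (int j + int p)"
      using cyc_dvd[of "j + p"] by (intro H_cong) simp
    finally show ?thesis .
  qed
  have "cyclic_word_period n (sum_vector S) = l"
    unfolding cyclic_word_period_def
  proof (rule Least_equality)
    have "?H (int j + int l) = ?H (int j)" for j
      by (intro hits_cong) simp
    then show "0 < l \<and> (\<forall>j\<in>{1..n}. sum_vector S (cyc n (j + l)) = sum_vector S j)"
      using l(1) per_iff by simp
  next
    fix p assume p: "0 < p \<and> (\<forall>j\<in>{1..n}. sum_vector S (cyc n (j + p)) = sum_vector S j)"
    have H_per: "?H (t + int p) = ?H t" for t
    proof -
      define j where "j = cyc n (nat (t mod int n))"
      have "int (nat (t mod int n)) = t mod int n" using n0 by simp
      then have "int n dvd int j - t mod int n" using cyc_dvd j_def by metis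
      then have dvd: "int n dvd int j - t"
        by (metis mod_diff_right_eq mod_eq_0_iff_dvd)
      have "?H (int j + int p) = ?H (int j)"
        using p per_iff[of j p] cyc_in j_def by blast
      then show ?thesis using H_cong[of "int j" t] H_cong[of "int j + int p" "t + int p"] dvd by simp
    qed
    have "int l dvd int p"
    proof (rule period_I, rule cnt_periodic_if_hits_periodic)
      have "int l dvd int P" by (simp add: T)
      then show "int l dvd int c * e + 1" "int l dvd W m"
        using P closed dvd_trans by auto
    qed (use l H_per in auto)
    then show "l \<le> p" using p by (auto intro: dvd_imp_le)
  qed
  moreover have "is_scroll n S"
    using window_independent by (auto simp: is_scroll_def S_def)
  ultimately show ?thesis by blast
qed

end

section \<open>The walks for given \<open>lam\<close> and \<open>k\<close>\<close>

lemma sum_of_bool_dvd_diff: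
  fixes t :: int
  assumes "0 < l"
  shows "(\<Sum>a<l. of_bool (int l dvd int a - t)) = (1::int)"
proof -
  have "int l dvd int a - t \<longleftrightarrow> int l dvd t - int a" for a
    by (metis dvd_minus_iff minus_diff_eq)
  then show ?thesis
    using sum_of_bool_dvd[OF assms, of 1 1 t] by (simp del: sum_of_bool_eq)
qed

theorem theorem5p6:
  fixes lam k :: nat
  assumes "odd lam" and "k \<ge> 4"
  shows "\<exists>S. is_scroll (k * lam) S \<and>
             cyclic_word_period (k * lam) (sum_vector S) = lam"
proof -
  define n where "n = k * lam"
  define r :: nat where "r = (if even k then 1 else 2)"
  obtain c where c2: "2 * c = lam + 1" using assms(1) by (metis evenE odd_even_add odd_one)
  \<comment> \<open>The number of long steps, for which \<open>W m = r * P\<close>: \<open>W\<close>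
    winds \<open>r\<close> times around modulo \<open>P\<close>.\<close>
  define q where "q = 2 * c * r - 1"
  have lam: "1 \<le> lam" using assms(1) by (auto elim: oddE)
  have n4: "4 * lam \<le> n" using assms(2) by (simp add: n_def)
  have "even (n + r - 1)" using assms(1) by (auto simp: n_def r_def)
  then obtain m where m: "2 * m = n + r - 1" by (metis evenE)
  define P where "P = c * (2 * n - 2) + 1"
  \<comment> \<open>\<open>P = (lam + 1) * n - lam\<close> is \<open>lam * T\<close>, and
    \<open>T\<close> is \<open>-1\<close> modulo \<open>k\<close>.\<close>
  define T where "T = (lam + 1) * k - 1"
  define last where "last = q + 1 - r"
  \<comment> \<open>A run of \<open>q - 1\<close> long steps and one more. If \<open>r = 1\<close>,
    the run starts once in each class modulo \<open>lam\<close> but one, and the short step at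
    \<open>lam - 1\<close> moves the extra start to class 1, already met when \<open>lam\<close> is
    at least 3. If \<open>r = 2\<close>, the run meets each class twice and the extra start follows
    directly.\<close>
  define I where "I = insert last {..<q - 1}"
  have r: "r = 1 \<or> r = 2" by (simp add: r_def)
  have q: "r = 1 \<Longrightarrow> q = lam" "r = 2 \<Longrightarrow> q = 2 * lam + 1" using c2 by (auto simp: q_def)
  have last: "r = 1 \<Longrightarrow> last = lam" "r = 2 \<Longrightarrow> last = 2 * lam"
    using q by (auto simp: last_def)
  have last_ge: "q - 1 \<le> last" using r q last by auto
  have cardI: "card I = q" using last_ge lam r q by (auto simp: I_def)
  have "last < m"
  proof (cases "r = 1")
    case True
    then show ?thesis using m last n4 lam by simp
  next
    case False
    then have "odd k" "r = 2" by (auto simp: r_def)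
    then have "5 \<le> k" using assms(2) by (cases "k = 4") auto
    then have "5 * lam \<le> n" by (simp add: n_def)
    then show ?thesis using m last \<open>r = 2\<close> lam by simp
  qed
  then have Im: "I \<subseteq> {..<m}" using last_ge by (auto simp: I_def)
  interpret snake_word n c m I
    using n4 lam c2 Im by unfold_locales auto
  have P: "int P = int c * e + 1"
    using n by (simp add: P_def e_def of_nat_diff)
  have q1: "q + 1 = 2 * c * r" using c r by (auto simp: q_def)
  have m': "int (2 * m + 1) = int n + int r" using m r by auto
  have area: "4 * c * m = P + card I"
  proof -
    have "int (4 * c * m) = 2 * int c * int (2 * m + 1) - 2 * int c" by (simp add: algebra_simps)
    also have "\<dots> = 2 * int c * (int n + int r) - 2 * int c" unfolding m' ..
    also have "\<dots> = int P + int (2 * c * r) - 1" by (simp add: P e_def algebra_simps)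
    also have "\<dots> = int (P + card I)" unfolding q1[symmetric] cardI by simp
    finally show ?thesis by linarith
  qed
  have closed: "W m = int r * int P"
  proof -
    have "W m = int (2 * m + 1) + (int n - 1) * int (q + 1) - int n"
      using Im by (simp add: W_card cardI Int_absorb2 algebra_simps)
    also have "\<dots> = int r * int P"
      unfolding m' q1 by (simp add: P e_def algebra_simps)
    finally show ?thesis .
  qed
  interpret closed_snake_word n c m I P
    using P area closed by unfold_locales simp_all
  have T: "int T = (int lam + 1) * int k - 1" using assms(2) by (simp add: T_def of_nat_diff algebra_simps)
  have PT: "P = lam * T"
  proof -
    have "int P = int (2 * c) * int n - int (2 * c) + 1" by (simp add: P e_def algebra_simps)
    also have "\<dots> = int (lam * T)" unfolding c2 by (simp add: T n_def algebra_simps)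
    finally show ?thesis by linarith
  qed
  have T0: "0 < T" using T assms(2) lam by (simp add: T_def)
  have cop: "coprime k T"
  proof (rule coprimeI)
    fix d assume d: "d dvd k" "d dvd T"
    have "Suc T = (lam + 1) * k" using T0 by (simp add: T_def)
    then have "d dvd Suc T" using d(1) by (metis dvd_mult)
    then have "d dvd Suc T - T" using d(2) by (rule dvd_diff_nat)
    then show "is_unit d" by simp
  qed
  have "int lam dvd p" if per: "\<And>t. cnt (int lam) I (t + p) = cnt (int lam) I t" for p
  proof (cases "lam = 1")
    case False
    with lam assms(1) have lam3: "3 \<le> lam" by (cases "lam = 2") auto
    define F where "F t = (\<Sum>a<q - 1. of_bool (int lam dvd int a - t) :: int)" for t
    have W_init: "int lam dvd W a - t \<longleftrightarrow> int lam dvd int a - t" if "a \<le> q - 1" for a t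
    proof -
      have "I \<inter> {..<a} = {..<a}" using that last_ge by (auto simp: I_def)
      then have "W a - t = int a - t + int n * int a" by (simp add: W_card algebra_simps)
      moreover have "int lam dvd int n * int a" by (simp add: n_def)
      ultimately show ?thesis by (simp only: dvd_add_left_iff)
    qed
    have cnt_eq: "cnt (int lam) I t = of_bool (int lam dvd W last - t) + F t" for t
    proof -
      have "sum g I = g last + sum g {..<q - 1}" for g :: "nat \<Rightarrow> int"
        using last_ge by (simp add: I_def)
      then show ?thesis by (simp add: cnt_def F_def W_init del: sum_of_bool_eq)
    qed
    have "F t \<le> F (W last)" for t
    proof (cases "r = 1")
      case True
      have "F t \<le> (\<Sum>a<lam. of_bool (int lam dvd int a - t))"
        unfolding F_def using q True by (intro sum_mono2) auto
      also have "\<dots> = 1" using lam by (intro sum_of_bool_dvd_diff) simp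
      also have "I \<inter> {..<last} = {..<lam - 1}" using last q True by (auto simp: I_def)
      then have "W last = 1 + int lam + int n * (int lam - 1)"
        using last True lam by (simp add: W_card of_nat_diff algebra_simps)
      then have "int lam dvd int 1 - W last" by (simp add: n_def)
      then have "1 \<le> F (W last)"
        unfolding F_def using q True lam3
          member_le_sum[of 1 "{..<q - 1}" "\<lambda>a. of_bool (int lam dvd int a - W last) :: int"]
        by simp
      finally show ?thesis .
    next
      case False
      then have q1: "q - 1 = lam + lam" using r q by simp
      have split: "(\<Sum>a<u + v. g a) = (\<Sum>a<u. g a) + (\<Sum>a<v. g (u + a))"
        for g :: "nat \<Rightarrow> int" and u v
        by (induction v) auto
      have "F t = 2" for t
      proof -
        have "F t = (\<Sum>a<lam. of_bool (int lam dvd int a - t)) +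
            (\<Sum>a<lam. of_bool (int lam dvd int a - (t - int lam)))"
          unfolding F_def q1 split by (simp add: algebra_simps del: sum_of_bool_eq)
        then show ?thesis using lam by (simp add: sum_of_bool_dvd_diff del: sum_of_bool_eq)
      qed
      then show ?thesis by simp
    qed
    \<comment> \<open>\<open>cnt\<close> is largest exactly in the class of \<open>W last\<close>,
      where the extra start adds to the maximum of \<open>F\<close>; a period must preserve this
      class.\<close>
    from this[of "W last + p"] per[of "W last"] show ?thesis
      by (cases "int lam dvd p") (auto simp: cnt_eq)
  qed simp
  then show ?thesis
    using scroll_exists[OF T0 PT _ n_def cop] lam unfolding n_def by simp
qed

end
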